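(* Let $X$ be a Banach space with weak*-sequentially compact dual ball, and let $\gamma_1,\gamma_2$ be ordinals. Let $Y\subset X$ be a closed linear subspace such that $Y$ has weak*-sequential dual ball with sequential order $\leq\gamma_1$ and the quotient $X/Y$ has weak*-sequential dual ball with sequential order $\leq\gamma_2$. Then $X$ has weak*-sequential dual ball with sequential order $\leq\gamma_1+\gamma_2$.
   Context: All topological spaces are Hausdorff. For a subset $F$ of a topological space $T$, the sequential closure of $F$ is the set of all limits (in $T$) of convergent sequences of elements of $F$; $F$ is sequentially closed if it equals its sequential closure; $T$ is sequential if every sequentially closed subset is closed. Define $S_\alpha(F)$ by transfinite induction: $S_0(F)=F$, $S_{\alpha+1}(F)$ is the sequential closure of $S_\alpha(F)$, and $S_\alpha(F)=\bigcup_{\beta<\alpha}S_\beta(F)$ for $\alpha$ a limit ordinal. (One has $S_\alpha(F)=S_{\omega_1}(F)$ for all $\alpha\ge\omega_1$, and $T$ is sequential iff $S_{\omega_1}(F)=\overline F$ for all $F\subset T$.) $T$ has sequential order $\alpha$ if $S_\alpha(F)=\overline F$ for every $F\subset T$ and for every $\beta<\alpha$ there is $F\subset T$ with $S_\beta(F)\neq\overline F$. Thus $T$ is sequential with sequential order $\le\alpha$ iff $S_\alpha(F)=\overline F$ for every $F\subset T$. $T$ is sequentially compact if every sequence in $T$ has a convergent subsequence. A Banach space $X$ has weak*-sequential (resp. weak*-sequentially compact) dual ball if the closed unit ball $B_{X^*}$ of $X^*$ with the weak* topology is sequential (resp. sequentially compact); "with sequential order $\le\alpha$" refers to the sequential order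 of $(B_{X^*},w^* )$. *)

theory Defs
  imports "HOL-Analysis.Analysis"
begin

section \<open>Ordinals\<close>

text \<open>
  An ordinal is given by a well-order relation on an arbitrary type, compared by \<^term>\<open>ordLeq\<close>
  and \<^term>\<open>ordLess\<close>. The ordinals below a nonzero \<open>r\<close> are, up to isomorphism, the
  proper initial segments \<^term>\<open>Restr r (underS r a)\<close> with \<open>a\<close> in the field of \<open>r\<close>.
\<close>

definition ord_sum :: "'a rel \<Rightarrow> 'b rel \<Rightarrow> ('a + 'b) rel" where
  "ord_sum r s = map_prod Inl Inl ` r \<union> map_prod Inr Inr ` s \<union>
     (Inl ` Field r) \<times> (Inr ` Field s)"

definition is_last :: "'a rel \<Rightarrow> 'a \<Rightarrow> bool" where
  "is_last r m \<longleftrightarrow> m \<in> Field r \<and> (\<forall>a\<in>Field r. (a, m) \<in> r)"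

text \<open>A nonzero ordinal is a successor iff it has a last element; its predecessor is then the
  initial segment below that element.\<close>

definition ord_pred :: "'a rel \<Rightarrow> 'a rel" where
  "ord_pred r = Restr r (underS r (THE m. is_last r m))"

section \<open>Sequential spaces and the sequential order\<close>

definition seq_closure :: "'a topology \<Rightarrow> 'a set \<Rightarrow> 'a set" where
  "seq_closure T F = {l. \<exists>\<sigma>. (\<forall>n. \<sigma> n \<in> F) \<and> limitin T \<sigma> l sequentially}"

definition sequential_space :: "'a topology \<Rightarrow> bool" where
  "sequential_space T \<longleftrightarrow> (\<forall>F. F \<subseteq> topspace T \<and> seq_closure T F = F \<longrightarrow> closedin T F)"

definition sequentially_compact_space :: "'a topology \<Rightarrow> bool" where
  "sequentially_compact_space T \<longleftrightarrow>
     (\<forall>\<sigma>. range \<sigma> \<subseteq> topspace T \<longrightarrow>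
        (\<exists>l \<phi>. strict_mono (\<phi> :: nat \<Rightarrow> nat) \<and> limitin T (\<sigma> \<circ> \<phi>) l sequentially))"

text \<open>\<open>seq_iter T F r\<close> is the set $S_\alpha(F)$, where $\alpha$ is the order type of \<open>r\<close>. The three
  branches are zero, successor and limit; the value on relations that are not well-orders is
  irrelevant.\<close>

function seq_iter :: "'a topology \<Rightarrow> 'a set \<Rightarrow> 'o rel \<Rightarrow> 'a set" where
  "seq_iter T F r =
     (if \<not> Well_order r \<or> r = {} then F
      else if \<exists>m. is_last r m then seq_closure T (seq_iter T F (ord_pred r))
      else (\<Union>a\<in>Field r. seq_iter T F (Restr r (underS r a))))"
  by pat_completeness auto
termination
proof (relation "inv_image ordLess (\<lambda>(T, F, r). r)")
  show "wf (inv_image ordLess (\<lambda>(T :: 'a topology, F :: 'a set, r :: 'o rel). r))"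
    by (rule wf_inv_image) (rule wf_ordLess)
next
  have *: "Field r \<noteq> {}" if "r \<noteq> {}" for r :: "'o rel"
    using that by (auto simp: Field_def)
  show "((T, F, ord_pred r), T, F, r) \<in> inv_image ordLess (\<lambda>(T, F, r). r)"
    if "\<not> (\<not> Well_order r \<or> r = {})" for T :: "'a topology" and F and r :: "'o rel"
    using that by (auto simp: ord_pred_def intro!: underS_Restr_ordLess *)
  show "((T, F, Restr r (underS r a)), T, F, r) \<in> inv_image ordLess (\<lambda>(T, F, r). r)"
    if "\<not> (\<not> Well_order r \<or> r = {})" for T :: "'a topology" and F and r :: "'o rel" and a
    using that by (auto intro!: underS_Restr_ordLess *)
qed

declare seq_iter.simps [simp del]

lemma seq_iter_zero: "seq_iter T F {} = F"
  by (simp add: seq_iter.simps)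

lemma seq_iter_successor:
  assumes r: "Well_order r" and m: "is_last r m"
  shows "seq_iter T F r = seq_closure T (seq_iter T F (Restr r (underS r m)))"
proof -
  have "antisym r"
    using r by (simp add: order_on_defs)
  then have "(THE m. is_last r m) = m"
    using m by (intro the_equality) (auto simp: is_last_def dest: antisymD)
  moreover have "r \<noteq> {}"
    using m by (auto simp: is_last_def)
  ultimately show ?thesis
    using r m by (subst seq_iter.simps) (auto simp: ord_pred_def)
qed

lemma seq_iter_limit:
  assumes "Well_order r" "r \<noteq> {}" "\<nexists>m. is_last r m"
  shows "seq_iter T F r = (\<Union>a\<in>Field r. seq_iter T F (Restr r (underS r a)))"
  using assms by (subst seq_iter.simps) auto

text \<open>Every ordinal below \<open>r\<close> has a representative on the type of \<open>r\<close>, so it is enough to let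
  \<open>s\<close> range over relations on that type in the next two definitions.\<close>

definition has_sequential_order :: "'a topology \<Rightarrow> 'o rel \<Rightarrow> bool" where
  "has_sequential_order T r \<longleftrightarrow>
     (\<forall>F \<subseteq> topspace T. seq_iter T F r = T closure_of F) \<and>
     (\<forall>s :: 'o rel. (s, r) \<in> ordLess \<longrightarrow> (\<exists>F \<subseteq> topspace T. seq_iter T F s \<noteq> T closure_of F))"

definition sequential_order_le :: "'a topology \<Rightarrow> 'o rel \<Rightarrow> bool" where
  "sequential_order_le T r \<longleftrightarrow> (\<exists>s :: 'o rel. (s, r) \<in> ordLeq \<and> has_sequential_order T s)"

section \<open>Dual balls\<close>

text \<open>A real normed space on an explicit carrier, so that a space, its subspaces and its quotients
  (whose points are cosets) can be treated uniformly.\<close>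

record 'v nspace =
  ncarrier :: "'v set"
  nadd :: "'v \<Rightarrow> 'v \<Rightarrow> 'v"
  nscale :: "real \<Rightarrow> 'v \<Rightarrow> 'v"
  nnorm :: "'v \<Rightarrow> real"

definition subspace_nspace :: "'a::real_normed_vector set \<Rightarrow> 'a nspace" where
  "subspace_nspace Y = \<lparr>ncarrier = Y, nadd = (+), nscale = (*\<^sub>R), nnorm = norm\<rparr>"

definition coset :: "'a::real_normed_vector set \<Rightarrow> 'a \<Rightarrow> 'a set" where
  "coset Y x = (\<lambda>y. x + y) ` Y"

text \<open>Scaling adds \<open>Y\<close> so that the multiple of a coset by zero is \<open>Y\<close> and not the singleton of zero.\<close>

definition quotient_nspace :: "'a::real_normed_vector set \<Rightarrow> 'a set nspace" where
  "quotient_nspace Y =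
     \<lparr>ncarrier = range (coset Y),
      nadd = (\<lambda>A B. {a + b | a b. a \<in> A \<and> b \<in> B}),
      nscale = (\<lambda>c A. {c *\<^sub>R a + y | a y. a \<in> A \<and> y \<in> Y}),
      nnorm = (\<lambda>A. INF a\<in>A. norm a)\<rparr>"

lemma nadd_quotient_nspace:
  assumes "subspace Y"
  shows "nadd (quotient_nspace Y) (coset Y x) (coset Y x') = coset Y (x + x')"
proof -
  have "\<exists>y\<in>Y. x + x' + (u + v) = x + x' + y" if "u \<in> Y" "v \<in> Y" for u v
    using that assms subspace_add by blast
  moreover have "\<exists>a b. x + x' + u = a + b \<and> a \<in> (+) x ` Y \<and> b \<in> (+) x' ` Y" if "u \<in> Y" for u
    using that subspace_0[OF assms]
    by (intro exI[of _ "x + u"] exI[of _ "x' + 0"] conjI imageI) auto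
  ultimately show ?thesis
    by (fastforce simp: quotient_nspace_def coset_def image_iff algebra_simps)
qed

lemma nscale_quotient_nspace:
  assumes "subspace Y"
  shows "nscale (quotient_nspace Y) c (coset Y x) = coset Y (c *\<^sub>R x)"
proof -
  have "c *\<^sub>R u + v \<in> Y" if "u \<in> Y" "v \<in> Y" for u v
    using that assms by (simp add: subspace_add subspace_scale)
  moreover have "\<exists>a y. c *\<^sub>R x + u = c *\<^sub>R a + y \<and> a \<in> (+) x ` Y \<and> y \<in> Y" if "u \<in> Y" for u
    using that subspace_0[OF assms]
    by (intro exI[of _ "x + 0"] exI[of _ u] conjI imageI) auto
  ultimately show ?thesis
    by (fastforce simp: quotient_nspace_def coset_def image_iff algebra_simps)
qed

lemma nnorm_quotient_nspace:
  assumes "subspace Y"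
  shows "nnorm (quotient_nspace Y) (coset Y x) = infdist x Y"
proof -
  have "norm ` coset Y x = dist x ` Y"
  proof safe
    fix z assume "z \<in> coset Y x"
    then obtain y where "y \<in> Y" "z = x + y" by (auto simp: coset_def)
    then show "norm z \<in> dist x ` Y"
      using assms by (intro image_eqI[of _ _ "- y"]) (auto simp: dist_norm subspace_neg)
  next
    fix y assume "y \<in> Y"
    then have "x + (- y) \<in> coset Y x"
      unfolding coset_def using assms subspace_neg by (intro imageI) blast
    then show "dist x y \<in> norm ` coset Y x"
      by (intro image_eqI[of _ _ "x + (- y)"]) (auto simp: dist_norm)
  qed
  moreover have "Y \<noteq> {}"
    using assms subspace_0 by blast
  ultimately show ?thesis
    by (simp add: quotient_nspace_def infdist_def)
qed

text \<open>Functionals are taken to be undefined off the carrier, so that equality of functionals is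
  equality on the carrier.\<close>

definition dual_space :: "'v nspace \<Rightarrow> ('v \<Rightarrow> real) set" where
  "dual_space N =
     {f \<in> extensional (ncarrier N).
        (\<forall>x\<in>ncarrier N. \<forall>y\<in>ncarrier N. f (nadd N x y) = f x + f y) \<and>
        (\<forall>c. \<forall>x\<in>ncarrier N. f (nscale N c x) = c * f x) \<and>
        (\<exists>K. \<forall>x\<in>ncarrier N. \<bar>f x\<bar> \<le> K * nnorm N x)}"

definition dual_norm :: "'v nspace \<Rightarrow> ('v \<Rightarrow> real) \<Rightarrow> real" where
  "dual_norm N f = (SUP x\<in>{x \<in> ncarrier N. nnorm N x \<le> 1}. \<bar>f x\<bar>)"

definition dual_ball :: "'v nspace \<Rightarrow> ('v \<Rightarrow> real) set" where
  "dual_ball N = {f \<in> dual_space N. dual_norm N f \<le> 1}"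

definition weak_star_topology :: "'v nspace \<Rightarrow> ('v \<Rightarrow> real) topology" where
  "weak_star_topology N =
     subtopology (product_topology (\<lambda>_. euclideanreal) (ncarrier N)) (dual_space N)"

definition weak_star_ball :: "'v nspace \<Rightarrow> ('v \<Rightarrow> real) topology" where
  "weak_star_ball N = subtopology (weak_star_topology N) (dual_ball N)"

lemma topspace_weak_star_ball: "topspace (weak_star_ball N) = dual_ball N"
  by (auto simp: weak_star_ball_def weak_star_topology_def dual_ball_def dual_space_def PiE_def)

text \<open>For a whole Banach space this is the unit ball of the library's space of bounded linear
  functionals.\<close>

lemma dual_ball_UNIV:
  "dual_ball (subspace_nspace (UNIV :: 'a::real_normed_vector set)) =
     blinfun_apply ` {f :: 'a \<Rightarrow>\<^sub>L real. norm f \<le> 1}"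
proof -
  have lin: "f \<in> dual_space (subspace_nspace UNIV) \<longleftrightarrow> bounded_linear f" for f :: "'a \<Rightarrow> real"
    by (auto simp: dual_space_def subspace_nspace_def linear_iff mult.commute
        bounded_linear_def bounded_linear_axioms_def)
  have nrm: "dual_norm (subspace_nspace UNIV) (blinfun_apply f) \<le> 1 \<longleftrightarrow> norm f \<le> 1"
    for f :: "'a \<Rightarrow>\<^sub>L real"
  proof
    assume *: "dual_norm (subspace_nspace UNIV) (blinfun_apply f) \<le> 1"
    have bdd: "bdd_above ((\<lambda>x. \<bar>f x\<bar>) ` {x. norm x \<le> 1})"
    proof (rule bdd_aboveI2)
      fix x :: 'a assume "x \<in> {x. norm x \<le> 1}"
      then show "\<bar>f x\<bar> \<le> norm f"
        using norm_blinfun[of f x] mult_left_mono[of "norm x" 1 "norm f"] by simp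
    qed
    have "\<bar>f x\<bar> \<le> 1" if "norm x \<le> 1" for x
      using cSUP_upper[OF _ bdd, of x] * that by (simp add: dual_norm_def subspace_nspace_def)
    then have le: "\<bar>f (x /\<^sub>R norm x)\<bar> \<le> 1" for x
      by (simp add: divide_simps)
    have "norm (f x) \<le> 1 * norm x" for x
      using le[of x] by (cases "x = 0") (auto simp: blinfun.scaleR_right abs_mult divide_simps)
    then show "norm f \<le> 1"
      by (intro norm_blinfun_bound) auto
  next
    assume *: "norm f \<le> 1"
    have "\<bar>f x\<bar> \<le> 1" if "norm x \<le> 1" for x
      using norm_blinfun[of f x] mult_mono[OF * that] by simp
    then show "dual_norm (subspace_nspace UNIV) (blinfun_apply f) \<le> 1"
      unfolding dual_norm_def subspace_nspace_def
      by (intro cSUP_least) (auto intro: exI[of _ 0])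
  qed
  show ?thesis
    unfolding dual_ball_def lin
    using nrm by (auto simp: image_iff blinfun.bounded_linear_right) 
      (metis bounded_linear_Blinfun_apply)
qed

definition weak_star_seq_compact_dual_ball :: "'v nspace \<Rightarrow> bool" where
  "weak_star_seq_compact_dual_ball N \<longleftrightarrow> sequentially_compact_space (weak_star_ball N)"

definition weak_star_sequential_dual_ball_le :: "'v nspace \<Rightarrow> 'o rel \<Rightarrow> bool" where
  "weak_star_sequential_dual_ball_le N r \<longleftrightarrow>
     sequential_space (weak_star_ball N) \<and> sequential_order_le (weak_star_ball N) r"

end

theory Submission
  imports Defs
begin

text \<open>
  Let \<open>f\<close> lie in the closure of a subset \<open>F\<close> of the dual ball. By sequential compactness, iterated
  sequential limits of restrictions to \<open>Y\<close> lift along the restriction map, so for every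
  neighbourhood \<open>V\<close> of \<open>f\<close> the restriction of \<open>f\<close> is also the restriction of some element of
  $S_{\gamma_1}(F \cap V)$. By regularity, \<open>f\<close> is in the closure of the set \<open>A\<close> of those elements of
  $S_{\gamma_1}(F)$ that agree with \<open>f\<close> on \<open>Y\<close>. The functionals $(g - f)/2$ with \<open>g\<close> in \<open>A\<close> vanish on
  \<open>Y\<close> and have norm at most one, so they live in the dual ball of the quotient, where the closure
  is $S_{\gamma_2}$. Translating back, \<open>f\<close> is in $S_{\gamma_2}(A)$, which is contained in
  $S_{\gamma_2}(S_{\gamma_1}(F)) \subseteq S_{\gamma_1 + \gamma_2}(F)$.
\<close>

section \<open>Initial segments and ordinal sums\<close>

abbreviation below :: "'o rel \<Rightarrow> 'o \<Rightarrow> 'o rel" where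
  "below r a \<equiv> Restr r (underS r a)"

lemma Well_order_below: "Well_order r \<Longrightarrow> Well_order (below r a)"
  by (rule Well_order_Restr)

lemma Field_below: "Well_order r \<Longrightarrow> Field (below r a) = underS r a"
  by (simp add: Field_Restr_ofilter wo_rel.underS_ofilter wo_rel_def)

lemma below_ordLess: "Well_order r \<Longrightarrow> a \<in> Field r \<Longrightarrow> (below r a, r) \<in> ordLess"
  by (rule underS_Restr_ordLess) auto

text \<open>Transitivity and antisymmetry make the points strictly below \<open>b\<close> lie
  strictly below \<open>a\<close> as well. This collapses the nested segments that arise when an
  induction hypothesis about \<open>below r a\<close> is applied at \<open>b\<close>.\<close>

lemma below_below:
  assumes "Well_order r" "b \<in> underS r a"
  shows "below (below r a) b = below r b"
proof -
  have "trans r" "antisym r"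
    using assms(1) by (auto simp: order_on_defs)
  then have "underS r b \<subseteq> underS r a"
    using assms(2) unfolding underS_def by (blast dest: transD antisymD)
  moreover from this have "underS (below r a) b = underS r b"
    using assms(2) by (auto simp: underS_def)
  ultimately show ?thesis
    by (simp add: Int_assoc Times_Int_Times Int_absorb1)
qed

text \<open>Transfinite induction over ordinals: every proper initial segment is a relation on the
  same type as \<open>r\<close>, so well-foundedness of \<open>ordLess\<close> on that one type
  suffices.\<close>

lemma Well_order_induct_below [consumes 1, case_names below]:
  assumes "Well_order r"
    and "\<And>r. Well_order r \<Longrightarrow> (\<And>a. a \<in> Field r \<Longrightarrow> P (below r a)) \<Longrightarrow> P r"
  shows "P r"
  using assms(1)
proof (induction r rule: wf_induct_rule[OF wf_ordLess])
  case (1 r)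
  then show ?case
    by (blast intro: assms(2) below_ordLess Well_order_below)
qed

lemma Field_ord_sum: "Field (ord_sum r s) = Inl ` Field r \<union> Inr ` Field s"
  unfolding ord_sum_def Field_def by force

lemma ord_sum_simps [simp]:
  "(Inl a, Inl b) \<in> ord_sum r s \<longleftrightarrow> (a, b) \<in> r"
  "(Inr c, Inr d) \<in> ord_sum r s \<longleftrightarrow> (c, d) \<in> s"
  "(Inl a, Inr d) \<in> ord_sum r s \<longleftrightarrow> a \<in> Field r \<and> d \<in> Field s"
  "(Inr c, Inl b) \<notin> ord_sum r s"
  unfolding ord_sum_def by (auto simp: map_prod_def image_iff split: prod.splits)

lemma Well_order_ord_sum:
  assumes r: "Well_order r" and s: "Well_order s"
  shows "Well_order (ord_sum r s)"
proof -
  let ?t = "ord_sum r s"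
  have rr: "refl_on (Field r) r" "trans r" "antisym r" "total_on (Field r) r" "wf (r - Id)"
    and ss: "refl_on (Field s) s" "trans s" "antisym s" "total_on (Field s) s" "wf (s - Id)"
    using r s by (auto simp: order_on_defs)
  have "refl_on (Field ?t) ?t"
    using rr(1) ss(1) by (auto simp: Field_ord_sum refl_on_def)
  moreover have "trans ?t"
  proof (rule transI)
    fix x y z assume "(x, y) \<in> ?t" "(y, z) \<in> ?t"
    then show "(x, z) \<in> ?t"
      using rr(2) ss(2) by (cases x; cases y; cases z) (auto dest: transD intro: FieldI1 FieldI2)
  qed
  moreover have "antisym ?t"
  proof (rule antisymI)
    fix x y assume "(x, y) \<in> ?t" "(y, x) \<in> ?t"
    then show "x = y"
      using rr(3) ss(3) by (cases x; cases y) (auto dest: antisymD)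
  qed
  moreover have "total_on (Field ?t) ?t"
    using rr(4) ss(4) by (fastforce simp: Field_ord_sum total_on_def)
  moreover have "wf (?t - Id)"
  proof (rule wfUNIVI)
    fix P x assume *: "\<forall>x. (\<forall>y. (y, x) \<in> ?t - Id \<longrightarrow> P y) \<longrightarrow> P x"
    \<comment> \<open>The left summand comes first. Below a point of the right summand lie all left
      points, so the second induction draws on this one.\<close>
    have l: "P (Inl a)" for a
    proof (induction a rule: wf_induct_rule[OF rr(5)])
      case (1 a)
      have "P y" if "(y, Inl a) \<in> ?t - Id" for y
        using that 1 by (cases y) auto
      then show ?case using * by blast
    qed
    have "P (Inr a)" for a
    proof (induction a rule: wf_induct_rule[OF ss(5)])
      case (1 a)
      have "P y" if "(y, Inr a) \<in> ?t - Id" for y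
        using that 1 l by (cases y) auto
      then show ?case using * by blast
    qed
    with l show "P x" by (cases x) auto
  qed
  moreover have "?t \<subseteq> Field ?t \<times> Field ?t"
    by (auto intro: FieldI1 FieldI2)
  ultimately show ?thesis
    by (simp add: order_on_defs)
qed

text \<open>The ordinals below \<open>r + s\<close> that are at least \<open>r\<close> are the sums
  \<open>r + s'\<close> with \<open>s'\<close> below \<open>s\<close>. This drives the induction on
  the right summand.\<close>

lemma below_ord_sum_Inr:
  assumes s: "Well_order s" and "b \<in> Field s"
  shows "below (ord_sum r s) (Inr b) = ord_sum r (below s b)"
proof -
  have "underS s b \<subseteq> Field s"
    by (auto simp: underS_def intro: FieldI1)
  then have "(x, y) \<in> below (ord_sum r s) (Inr b) \<longleftrightarrow> (x, y) \<in> ord_sum r (below s b)" for x y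
    using \<open>b \<in> Field s\<close> Field_below[OF s, of b]
    by (cases x; cases y) (auto simp: underS_def intro: FieldI1 FieldI2)
  then show ?thesis by auto
qed

text \<open>\<open>Inl\<close> is an embedding because no right point lies below a left one.\<close>

lemma ordLeq_ord_sum:
  assumes r: "Well_order r" and s: "Well_order s"
  shows "(r, ord_sum r s) \<in> ordLeq"
proof -
  have "embed r (ord_sum r s) Inl"
    unfolding embed_def bij_betw_def
  proof (intro ballI conjI)
    fix a
    show "Inl ` under r a = under (ord_sum r s) (Inl a)"
    proof (intro equalityI subsetI)
      fix x assume "x \<in> under (ord_sum r s) (Inl a)"
      then show "x \<in> Inl ` under r a" by (cases x) (auto simp: under_def)
    qed (auto simp: under_def)
  qed simp
  then show ?thesis
    using Well_order_ord_sum[OF assms] r by (auto simp: ordLeq_def)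
qed

section \<open>The iterated sequential closure\<close>

lemma seq_closure_mono: "F \<subseteq> G \<Longrightarrow> seq_closure T F \<subseteq> seq_closure T G"
  unfolding seq_closure_def by blast

lemma seq_closure_extensive: "F \<subseteq> topspace T \<Longrightarrow> F \<subseteq> seq_closure T F"
proof
  fix x assume "F \<subseteq> topspace T" "x \<in> F"
  then have "limitin T (\<lambda>_. x) x sequentially"
    by (auto simp: limitin_def)
  with \<open>x \<in> F\<close> show "x \<in> seq_closure T F"
    unfolding seq_closure_def by (auto intro!: exI[of _ "\<lambda>_. x"])
qed

lemma seq_closure_subset_closure_of: "seq_closure T F \<subseteq> T closure_of F"
proof
  fix l assume "l \<in> seq_closure T F"
  then obtain \<sigma> where "\<And>n. \<sigma> n \<in> F" "limitin T \<sigma> l sequentially"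
    by (auto simp: seq_closure_def)
  then show "l \<in> T closure_of F"
    unfolding in_closure_of limitin_sequentially by blast
qed

lemma seq_iter_subset_closure_of:
  assumes "Well_order r" "F \<subseteq> topspace T"
  shows "seq_iter T F r \<subseteq> T closure_of F"
  using assms(1)
proof (induction r rule: Well_order_induct_below)
  case (below r)
  consider "r = {}" | m where "is_last r m" | "r \<noteq> {}" "\<nexists>m. is_last r m" by blast
  then show ?case
  proof cases
    case 1
    then show ?thesis
      by (simp add: seq_iter_zero closure_of_subset assms)
  next
    case 2
    then have "seq_iter T F (below r m) \<subseteq> T closure_of F"
      using below by (auto simp: is_last_def)
    then have "T closure_of seq_iter T F (below r m) \<subseteq> T closure_of F"
      by (rule closure_of_minimal) simp
    then show ?thesis
      unfolding seq_iter_successor[OF below(1) 2]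
      by (rule subset_trans[OF seq_closure_subset_closure_of])
  next
    case 3
    then show ?thesis
      using below by (auto simp: seq_iter_limit)
  qed
qed

lemma seq_iter_subset_topspace:
  "Well_order r \<Longrightarrow> F \<subseteq> topspace T \<Longrightarrow> seq_iter T F r \<subseteq> topspace T"
  using seq_iter_subset_closure_of closure_of_subset_topspace by (metis subset_trans)

lemma seq_closure_seq_iter_below_subset:
  assumes r: "Well_order r" and F: "F \<subseteq> topspace T" and "b \<in> Field r"
  shows "seq_closure T (seq_iter T F (below r b)) \<subseteq> seq_iter T F r"
  using r \<open>b \<in> Field r\<close>
proof (induction r arbitrary: b rule: Well_order_induct_below)
  case (below r)
  note r = below(1)
  have IH: "seq_closure T (seq_iter T F (below r b)) \<subseteq> seq_iter T F (below r a)"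
    if a: "a \<in> Field r" and b: "b \<in> underS r a" for a
    using below(2)[OF a, of b] unfolding Field_below[OF r] below_below[OF r b] by (simp add: b)
  show ?case
  proof (cases "\<exists>m. is_last r m")
    case True
    then obtain m where m: "is_last r m" by blast
    show ?thesis
    proof (cases "b = m")
      case True
      show ?thesis
        unfolding True seq_iter_successor[OF r m, of T F] by (rule subset_refl)
    next
      case False
      have "m \<in> Field r" "b \<in> underS r m"
        using m below(3) False by (auto simp: is_last_def underS_def)
      then have "seq_closure T (seq_iter T F (below r b)) \<subseteq> seq_iter T F (below r m)"
        by (rule IH)
      also have "\<dots> \<subseteq> seq_iter T F r"
        unfolding seq_iter_successor[OF r m, of T F]
        by (intro seq_closure_extensive seq_iter_subset_topspace Well_order_below r F)
      finally show ?thesis .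
    qed
  next
    case False
    \<comment> \<open>Without a last element, some \<open>a\<close> lies strictly above
      \<open>b\<close>. The induction hypothesis at \<open>a\<close> then places the successor stage
      of \<open>b\<close> inside the union.\<close>
    then obtain a where a: "a \<in> Field r" "(a, b) \<notin> r"
      using below(3) by (auto simp: is_last_def)
    moreover have "total_on (Field r) r" "refl_on (Field r) r"
      using r by (auto simp: order_on_defs)
    ultimately have "b \<in> underS r a"
      using below(3) unfolding underS_def total_on_def refl_on_def by fastforce
    with a(1) have "seq_closure T (seq_iter T F (below r b)) \<subseteq> seq_iter T F (below r a)"
      by (rule IH)
    also have "\<dots> \<subseteq> (\<Union>a\<in>Field r. seq_iter T F (below r a))"
      using a(1) by (rule UN_upper)
    also have "\<dots> = seq_iter T F r"
      using a(1) False by (intro seq_iter_limit[symmetric] r) auto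
    finally show ?thesis .
  qed
qed

lemma subset_seq_iter:
  assumes r: "Well_order r" and F: "F \<subseteq> topspace T"
  shows "F \<subseteq> seq_iter T F r"
  using r
proof (induction r rule: Well_order_induct_below)
  case (below r)
  show ?case
  proof (cases "r = {}")
    case False
    then obtain a where "a \<in> Field r" by (auto simp: Field_def)
    with below have "F \<subseteq> seq_iter T F (below r a)" by blast
    also have "\<dots> \<subseteq> seq_closure T (seq_iter T F (below r a))"
      by (intro seq_closure_extensive seq_iter_subset_topspace Well_order_below below(1) F)
    also have "\<dots> \<subseteq> seq_iter T F r"
      by (intro seq_closure_seq_iter_below_subset below(1) F \<open>a \<in> Field r\<close>)
    finally show ?thesis .
  qed (simp add: seq_iter_zero)
qed

text \<open>Unlike the defining recursion, this formula treats zero, successors and limits alike, so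
  the inductions below need no case distinction.\<close>

lemma seq_iter_eq_UN:
  assumes r: "Well_order r" and F: "F \<subseteq> topspace T"
  shows "seq_iter T F r = F \<union> (\<Union>a\<in>Field r. seq_closure T (seq_iter T F (below r a)))"
    (is "_ = ?U")
proof
  show "?U \<subseteq> seq_iter T F r"
    by (intro Un_least UN_least subset_seq_iter[OF r F] seq_closure_seq_iter_below_subset[OF r F])
  have ext: "seq_iter T F (below r a) \<subseteq> seq_closure T (seq_iter T F (below r a))" for a
    by (intro seq_closure_extensive seq_iter_subset_topspace Well_order_below assms)
  consider "r = {}" | m where "is_last r m" | "r \<noteq> {}" "\<nexists>m. is_last r m" by blast
  then show "seq_iter T F r \<subseteq> ?U"
  proof cases
    case 1
    then show ?thesis by (simp add: seq_iter_zero)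
  next
    case 2
    then show ?thesis
      unfolding seq_iter_successor[OF r 2, of T F] by (auto simp: is_last_def)
  next
    case 3
    then show ?thesis
      unfolding seq_iter_limit[OF r 3, of T F] using ext by (intro UN_least) blast
  qed
qed

text \<open>The two relations may live on different types, as \<open>\<gamma>1\<close> and
  \<open>ord_sum \<gamma>1 \<gamma>2\<close> do. Since isomorphic well-orders are
  \<open>ordLeq\<close> both ways, this also gives invariance under order isomorphism.\<close>

lemma seq_iter_ordLeq_mono:
  fixes r :: "'o rel" and s :: "'p rel"
  assumes F: "F \<subseteq> topspace T" and "(r, s) \<in> ordLeq"
  shows "seq_iter T F r \<subseteq> seq_iter T F s"
proof -
  have "Well_order r"
    using assms(2) by (simp add: ordLeq_def)
  then show ?thesis
    using assms(2)
  proof (induction r arbitrary: s rule: Well_order_induct_below)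
    case (below r)
    have s: "Well_order s"
      using below(3) by (simp add: ordLeq_def)
    have "seq_closure T (seq_iter T F (below r a)) \<subseteq> seq_iter T F s" if a: "a \<in> Field r" for a
    proof -
      have "(below r a, s) \<in> ordLess"
        using below_ordLess[OF below(1) a] below(3) by (rule ordLess_ordLeq_trans)
      \<comment> \<open>An ordinal less than \<open>s\<close> is isomorphic to a segment of
        \<open>s\<close>, which brings the stage \<open>below r a\<close> over to the type of
        \<open>s\<close>.\<close>
      then obtain b where b: "b \<in> Field s" "(below r a, below s b) \<in> ordIso"
        using ordLess_iff_ordIso_Restr[OF s Well_order_below[OF below(1)]] by blast
      then have "seq_iter T F (below r a) \<subseteq> seq_iter T F (below s b)"
        using below(2)[OF a] ordIso_iff_ordLeq by blast
      from seq_closure_mono[OF this] show ?thesis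
        using seq_closure_seq_iter_below_subset[OF s F b(1)] by (rule subset_trans)
    qed
    then show ?case
      unfolding seq_iter_eq_UN[OF below(1) F] by (intro Un_least UN_least subset_seq_iter[OF s F])
  qed
qed

lemma seq_iter_mono:
  assumes "Well_order r" and "F \<subseteq> G" and G: "G \<subseteq> topspace T"
  shows "seq_iter T F r \<subseteq> seq_iter T G r"
  using assms(1)
proof (induction r rule: Well_order_induct_below)
  case (below r)
  have "F \<subseteq> topspace T"
    using assms by blast
  show ?case
    unfolding seq_iter_eq_UN[OF below(1) \<open>F \<subseteq> topspace T\<close>] seq_iter_eq_UN[OF below(1) G]
    by (intro Un_mono UN_mono seq_closure_mono below(2) \<open>F \<subseteq> G\<close> subset_refl)
qed

text \<open>Induction on the right summand. The starting set is the stage \<open>r\<close>, which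
  precedes \<open>r + s\<close>; each later stage \<open>below s b\<close> becomes the stage of the
  sum below \<open>Inr b\<close>.\<close>

lemma seq_iter_seq_iter_subset:
  assumes r: "Well_order r" and s: "Well_order s" and F: "F \<subseteq> topspace T"
  shows "seq_iter T (seq_iter T F r) s \<subseteq> seq_iter T F (ord_sum r s)"
  using s
proof (induction s rule: Well_order_induct_below)
  case (below s)
  have rs: "Well_order (ord_sum r s)"
    by (rule Well_order_ord_sum[OF r below(1)])
  have "seq_closure T (seq_iter T (seq_iter T F r) (below s b)) \<subseteq> seq_iter T F (ord_sum r s)"
    if b: "b \<in> Field s" for b
  proof -
    have "seq_closure T (seq_iter T (seq_iter T F r) (below s b))
        \<subseteq> seq_closure T (seq_iter T F (below (ord_sum r s) (Inr b)))"
      unfolding below_ord_sum_Inr[OF below(1) b] by (rule seq_closure_mono[OF below(2)[OF b]])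
    also have "\<dots> \<subseteq> seq_iter T F (ord_sum r s)"
      using b by (intro seq_closure_seq_iter_below_subset rs F) (simp add: Field_ord_sum)
    finally show ?thesis .
  qed
  then show ?case
    unfolding seq_iter_eq_UN[OF below(1) seq_iter_subset_topspace[OF r F]]
    by (intro Un_least UN_least seq_iter_ordLeq_mono F ordLeq_ord_sum r below(1))
qed

section \<open>Transport of the iterates along maps\<close>

text \<open>Continuity is asked for only along sequences in \<open>A\<close>, and \<open>A\<close>
  must contain their limits, so that all iterates stay where \<open>h\<close> is controlled. This
  suits a map that sends only part of \<open>T\<close> into \<open>T'\<close>.\<close>

lemma seq_iter_seq_continuous_image:
  assumes r: "Well_order r" and "F \<subseteq> A" and A: "A \<subseteq> topspace T" and h: "h ` A \<subseteq> topspace T'"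
    and lim: "\<And>\<sigma> l. (\<And>n. \<sigma> n \<in> A) \<Longrightarrow> limitin T \<sigma> l sequentially \<Longrightarrow>
      l \<in> A \<and> limitin T' (h \<circ> \<sigma>) (h l) sequentially"
  shows "seq_iter T F r \<subseteq> A \<and> h ` seq_iter T F r \<subseteq> seq_iter T' (h ` F) r"
  using r
proof (induction r rule: Well_order_induct_below)
  case (below r)
  have F: "F \<subseteq> topspace T" "h ` F \<subseteq> topspace T'"
    using assms by auto
  have "l \<in> A \<and> h l \<in> seq_closure T' (seq_iter T' (h ` F) (below r a))"
    if a: "a \<in> Field r" and l: "l \<in> seq_closure T (seq_iter T F (below r a))" for a l
  proof -
    obtain \<sigma> where \<sigma>: "\<And>n. \<sigma> n \<in> seq_iter T F (below r a)" "limitin T \<sigma> l sequentially"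
      using l by (auto simp: seq_closure_def)
    have "\<sigma> n \<in> A" "(h \<circ> \<sigma>) n \<in> seq_iter T' (h ` F) (below r a)" for n
      using \<sigma>(1) below(2)[OF a] by auto
    then show ?thesis
      using lim[OF _ \<sigma>(2)] unfolding seq_closure_def by blast
  qed
  then show ?case
    unfolding seq_iter_eq_UN[OF below(1) F(1)] seq_iter_eq_UN[OF below(1) F(2)]
    using \<open>F \<subseteq> A\<close> by blast
qed

text \<open>A sequence downstairs is lifted term by term, and sequential compactness yields a
  convergent subsequence of the lifts. Its limit maps to the original limit because limits in
  \<open>T'\<close> are unique.\<close>

lemma seq_iter_image_lift:
  assumes T: "sequentially_compact_space T" and T': "Hausdorff_space T'"
    and h: "continuous_map T T' h" and r: "Well_order r" and F: "F \<subseteq> topspace T"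
  shows "seq_iter T' (h ` F) r \<subseteq> h ` seq_iter T F r"
  using r
proof (induction r rule: Well_order_induct_below)
  case (below r)
  have hF: "h ` F \<subseteq> topspace T'"
    using h F continuous_map_image_subset_topspace by blast
  have "y \<in> h ` seq_closure T (seq_iter T F (below r a))"
    if a: "a \<in> Field r" and y: "y \<in> seq_closure T' (seq_iter T' (h ` F) (below r a))" for a y
  proof -
    obtain \<tau> where \<tau>: "\<And>n. \<tau> n \<in> seq_iter T' (h ` F) (below r a)" "limitin T' \<tau> y sequentially"
      using y by (auto simp: seq_closure_def)
    then have "\<forall>n. \<exists>x. x \<in> seq_iter T F (below r a) \<and> h x = \<tau> n"
      using below(2)[OF a] by (metis (no_types, lifting) imageE subsetD)
    then obtain \<sigma> where \<sigma>: "\<And>n. \<sigma> n \<in> seq_iter T F (below r a)" "\<And>n. h (\<sigma> n) = \<tau> n"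
      by metis
    then have "range \<sigma> \<subseteq> topspace T"
      using seq_iter_subset_topspace[OF Well_order_below[OF below(1)] F] by blast
    then obtain l \<phi> where \<phi>: "strict_mono (\<phi> :: nat \<Rightarrow> nat)"
        and l: "limitin T (\<sigma> \<circ> \<phi>) l sequentially"
      using T unfolding sequentially_compact_space_def by blast
    have "h \<circ> (\<sigma> \<circ> \<phi>) = \<tau> \<circ> \<phi>"
      using \<sigma>(2) by auto
    then have "limitin T' (\<tau> \<circ> \<phi>) (h l) sequentially"
      using continuous_map_limit[OF h l] by simp
    then have "h l = y"
      using limitin_subsequence[OF \<phi> \<tau>(2)] T' by (intro limitin_Hausdorff_unique) auto
    moreover have "l \<in> seq_closure T (seq_iter T F (below r a))"
      unfolding seq_closure_def using l \<sigma>(1) by (auto intro!: exI[of _ "\<sigma> \<circ> \<phi>"])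
    ultimately show ?thesis by blast
  qed
  then show ?case
    unfolding seq_iter_eq_UN[OF below(1) F] seq_iter_eq_UN[OF below(1) hF] by blast
qed

section \<open>Bounds on the sequential order as equations for closures\<close>

text \<open>The exact order \<open>s\<close> lies at or below \<open>r\<close>, so the iterate at
  \<open>r\<close> is squeezed between the one at \<open>s\<close>, which is already the closure,
  and the closure itself.\<close>

lemma sequential_order_leD:
  fixes r :: "'o rel"
  assumes "sequential_order_le T r" "F \<subseteq> topspace T"
  shows "seq_iter T F r = T closure_of F"
proof -
  obtain s :: "'o rel" where s: "(s, r) \<in> ordLeq" "seq_iter T F s = T closure_of F"
    using assms by (auto simp: sequential_order_le_def has_sequential_order_def)
  then have "Well_order r" by (simp add: ordLeq_def)
  then show ?thesis
    using seq_iter_ordLeq_mono[OF assms(2) s(1)] seq_iter_subset_closure_of[OF _ assms(2), of r] s(2)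
    by auto
qed

text \<open>The exact order demanded by the definition is a minimal well-order on this type for
  which all the closure equations hold.\<close>

lemma sequential_order_leI:
  fixes r :: "'o rel"
  assumes r: "Well_order r" and eq: "\<And>F. F \<subseteq> topspace T \<Longrightarrow> seq_iter T F r = T closure_of F"
  shows "sequential_order_le T r"
proof -
  define Q where "Q = {s :: 'o rel. Well_order s \<and> (\<forall>F \<subseteq> topspace T. seq_iter T F s = T closure_of F)}"
  have "r \<in> Q" using assms by (auto simp: Q_def)
  then obtain s where s: "s \<in> Q" "\<And>s'. (s', s) \<in> ordLess \<Longrightarrow> s' \<notin> Q"
    using wfE_min[OF wf_ordLess] by metis
  have "(s, r) \<in> ordLeq"
    using s \<open>r \<in> Q\<close> r not_ordLess_iff_ordLeq[of s r] by (auto simp: Q_def)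
  moreover have "has_sequential_order T s"
    unfolding has_sequential_order_def
  proof (intro conjI allI impI)
    fix s' :: "'o rel" assume "(s', s) \<in> ordLess"
    then show "\<exists>F \<subseteq> topspace T. seq_iter T F s' \<noteq> T closure_of F"
      using s(2)[of s'] by (auto simp: Q_def ordLess_def)
  qed (use s(1) in \<open>auto simp: Q_def\<close>)
  ultimately show ?thesis
    unfolding sequential_order_le_def by blast
qed

lemma seq_iter_seq_closed:
  assumes r: "Well_order r" and F: "F \<subseteq> topspace T" "seq_closure T F = F"
  shows "seq_iter T F r = F"
  using r
proof (induction r rule: Well_order_induct_below)
  case (below r)
  then show ?case
    unfolding seq_iter_eq_UN[OF below(1) F(1)] by (auto simp: F(2))
qed

lemma sequential_order_le_imp_sequential_space:
  assumes "Well_order r" "sequential_order_le T r"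
  shows "sequential_space T"
  unfolding sequential_space_def
proof (intro allI impI, elim conjE)
  fix F assume F: "F \<subseteq> topspace T" "seq_closure T F = F"
  then have "T closure_of F = F"
    using seq_iter_seq_closed[OF assms(1) F] sequential_order_leD[OF assms(2) F(1)] by simp
  then show "closedin T F"
    by (simp add: closure_of_eq)
qed

section \<open>Weak-star dual balls\<close>

text \<open>A common setting for subspaces and quotients, with what is used to describe the dual
  ball by a pointwise bound.\<close>

locale seminormed_nspace =
  fixes N :: "'v nspace"
  assumes carrier_nonempty: "ncarrier N \<noteq> {}"
    and add_closed: "x \<in> ncarrier N \<Longrightarrow> y \<in> ncarrier N \<Longrightarrow> nadd N x y \<in> ncarrier N"
    and scale_closed: "x \<in> ncarrier N \<Longrightarrow> nscale N c x \<in> ncarrier N"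
    and norm_nonneg: "x \<in> ncarrier N \<Longrightarrow> 0 \<le> nnorm N x"
    and norm_scale: "x \<in> ncarrier N \<Longrightarrow> nnorm N (nscale N c x) = \<bar>c\<bar> * nnorm N x"
begin

text \<open>The supremum in \<open>dual_norm\<close> is traded for a bound at every vector by
  normalising. At vectors of norm zero, the bound with the constant \<open>K\<close> forces the
  functional to vanish.\<close>

lemma dual_ball_iff:
  "f \<in> dual_ball N \<longleftrightarrow> f \<in> extensional (ncarrier N) \<and>
     (\<forall>x\<in>ncarrier N. \<forall>y\<in>ncarrier N. f (nadd N x y) = f x + f y) \<and>
     (\<forall>c. \<forall>x\<in>ncarrier N. f (nscale N c x) = c * f x) \<and>
     (\<forall>x\<in>ncarrier N. \<bar>f x\<bar> \<le> nnorm N x)"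
    (is "_ \<longleftrightarrow> ?lin \<and> ?add \<and> ?scale \<and> ?le")
proof
  assume f: "f \<in> dual_ball N"
  then obtain K where K: "\<And>x. x \<in> ncarrier N \<Longrightarrow> \<bar>f x\<bar> \<le> K * nnorm N x"
    and sc: "\<And>c x. x \<in> ncarrier N \<Longrightarrow> f (nscale N c x) = c * f x"
    and le1: "dual_norm N f \<le> 1"
    unfolding dual_ball_def dual_space_def by blast
  have "\<bar>f x\<bar> \<le> nnorm N x" if x: "x \<in> ncarrier N" for x
  proof (cases "nnorm N x = 0")
    case True
    then show ?thesis using K[OF x] by simp
  next
    case False
    define z where "z = nscale N (1 / nnorm N x) x"
    have z: "z \<in> {x \<in> ncarrier N. nnorm N x \<le> 1}"
      using False x norm_nonneg[OF x] by (simp add: z_def scale_closed norm_scale)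
    have "bdd_above ((\<lambda>x. \<bar>f x\<bar>) ` {x \<in> ncarrier N. nnorm N x \<le> 1})"
    proof (rule bdd_aboveI2)
      fix y assume "y \<in> {x \<in> ncarrier N. nnorm N x \<le> 1}"
      then have y: "y \<in> ncarrier N" "nnorm N y \<le> 1" by auto
      have "\<bar>f y\<bar> \<le> \<bar>K\<bar> * nnorm N y"
        using K[OF y(1)] mult_right_mono[OF abs_ge_self[of K] norm_nonneg[OF y(1)]] by linarith
      also have "\<dots> \<le> \<bar>K\<bar>"
        using mult_left_mono[OF y(2), of "\<bar>K\<bar>"] by simp
      finally show "\<bar>f y\<bar> \<le> \<bar>K\<bar>" .
    qed
    from cSUP_upper[OF z this] have "\<bar>f z\<bar> \<le> 1"
      using le1 by (simp add: dual_norm_def)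
    then show ?thesis
      using False norm_nonneg[OF x] x by (simp add: z_def sc abs_mult divide_simps split: if_splits)
  qed
  then show "?lin \<and> ?add \<and> ?scale \<and> ?le"
    using f by (auto simp: dual_ball_def dual_space_def)
next
  assume *: "?lin \<and> ?add \<and> ?scale \<and> ?le"
  obtain x where "x \<in> ncarrier N" using carrier_nonempty by blast
  \<comment> \<open>The zero multiple shows that the supremum defining \<open>dual_norm\<close> is
    taken over a nonempty set.\<close>
  then have "nscale N 0 x \<in> {x \<in> ncarrier N. nnorm N x \<le> 1}"
    by (simp add: scale_closed norm_scale)
  then have "dual_norm N f \<le> 1"
    unfolding dual_norm_def using * by (intro cSUP_least) force+
  moreover have "\<exists>K. \<forall>x\<in>ncarrier N. \<bar>f x\<bar> \<le> K * nnorm N x"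
    using * by (intro exI[of _ 1]) simp
  ultimately show "f \<in> dual_ball N"
    using * unfolding dual_ball_def dual_space_def by blast
qed

text \<open>Each condition in \<open>dual_ball_iff\<close> is an equation or weak inequality between
  finitely many values, hence survives pointwise limits.\<close>

lemma dual_ball_pointwise_limit:
  assumes \<sigma>: "\<And>n. \<sigma> n \<in> dual_ball N" and l: "l \<in> extensional (ncarrier N)"
    and lim: "\<And>x. x \<in> ncarrier N \<Longrightarrow> (\<lambda>n. \<sigma> n x) \<longlonglongrightarrow> l x"
  shows "l \<in> dual_ball N"
  unfolding dual_ball_iff
proof (intro conjI ballI allI l)
  fix x y assume xy: "x \<in> ncarrier N" "y \<in> ncarrier N"
  have "(\<lambda>n. \<sigma> n (nadd N x y)) \<longlonglongrightarrow> l x + l y"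
    using tendsto_add[OF lim[OF xy(1)] lim[OF xy(2)]] \<sigma> xy by (simp add: dual_ball_iff)
  then show "l (nadd N x y) = l x + l y"
    using lim[OF add_closed[OF xy]] LIMSEQ_unique by blast
next
  fix c x assume x: "x \<in> ncarrier N"
  have "(\<lambda>n. \<sigma> n (nscale N c x)) \<longlonglongrightarrow> c * l x"
    using tendsto_mult_left[OF lim[OF x], of c] \<sigma> x by (simp add: dual_ball_iff)
  then show "l (nscale N c x) = c * l x"
    using lim[OF scale_closed[OF x]] LIMSEQ_unique by blast
next
  fix x assume x: "x \<in> ncarrier N"
  show "\<bar>l x\<bar> \<le> nnorm N x"
    using tendsto_rabs[OF lim[OF x]] \<sigma> x
    by (intro LIMSEQ_le_const2[of "\<lambda>n. \<bar>\<sigma> n x\<bar>"]) (auto simp: dual_ball_iff)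
qed

end

lemma limitin_weak_star_ball:
  assumes "\<And>n. \<sigma> n \<in> dual_ball N"
  shows "limitin (weak_star_ball N) \<sigma> l sequentially \<longleftrightarrow>
    l \<in> dual_ball N \<and> (\<forall>x\<in>ncarrier N. (\<lambda>n. \<sigma> n x) \<longlonglongrightarrow> l x)"
proof -
  have sub: "f \<in> dual_space N \<and> f \<in> extensional (ncarrier N)" if "f \<in> dual_ball N" for f
    using that by (auto simp: dual_ball_def dual_space_def)
  then show ?thesis
    using assms
    by (auto simp: weak_star_ball_def weak_star_topology_def limitin_subtopology
        limitin_componentwise PiE_def)
qed

lemma continuous_map_weak_star_ball_eval:
  "x \<in> ncarrier N \<Longrightarrow> continuous_map (weak_star_ball N) euclideanreal (\<lambda>f. f x)"
  unfolding weak_star_ball_def weak_star_topology_def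
  by (intro continuous_map_from_subtopology continuous_map_product_projection)

lemma continuous_map_into_weak_star_ball:
  assumes "h ` topspace T \<subseteq> dual_ball N"
    and "\<And>x. x \<in> ncarrier N \<Longrightarrow> continuous_map T euclideanreal (\<lambda>p. h p x)"
  shows "continuous_map T (weak_star_ball N) h"
proof -
  have "dual_ball N \<subseteq> dual_space N" "dual_ball N \<subseteq> extensional (ncarrier N)"
    by (auto simp: dual_ball_def dual_space_def)
  then show ?thesis
    using assms unfolding weak_star_ball_def weak_star_topology_def
    by (auto simp: continuous_map_in_subtopology continuous_map_componentwise)
qed

lemma Hausdorff_weak_star_ball: "Hausdorff_space (weak_star_ball N)"
  unfolding weak_star_ball_def weak_star_topology_def
  by (intro Hausdorff_space_subtopology) (simp add: Hausdorff_space_product_topology)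

lemma regular_weak_star_ball: "regular_space (weak_star_ball N)"
  unfolding weak_star_ball_def weak_star_topology_def
  by (intro regular_space_subtopology) (simp add: regular_space_product_topology regular_space_euclidean)

section \<open>Dual balls of subspaces and quotients\<close>

lemma seminormed_subspace_nspace:
  assumes "subspace Y"
  shows "seminormed_nspace (subspace_nspace Y)"
  using assms subspace_0[OF assms]
  by unfold_locales (auto simp: subspace_nspace_def subspace_add subspace_scale)

lemma infdist_scaleR_subspace:
  fixes Y :: "'a::real_normed_vector set"
  assumes Y: "subspace Y"
  shows "infdist (c *\<^sub>R x) Y = \<bar>c\<bar> * infdist x Y"
proof (cases "c = 0")
  case False
  \<comment> \<open>One inequality is enough: it is used with \<open>c\<close>, and with
    \<open>1 / c\<close> at the vector \<open>c *\<^sub>R x\<close> for the converse.\<close>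
  have le: "infdist (d *\<^sub>R z) Y \<le> \<bar>d\<bar> * infdist z Y" if "d \<noteq> 0" for d :: real and z
  proof -
    have "infdist (d *\<^sub>R z) Y / \<bar>d\<bar> \<le> dist z y" if "y \<in> Y" for y
    proof -
      have "infdist (d *\<^sub>R z) Y \<le> dist (d *\<^sub>R z) (d *\<^sub>R y)"
        by (intro infdist_le subspace_scale Y that)
      also have "\<dots> = \<bar>d\<bar> * dist z y"
        by (simp add: dist_norm flip: scaleR_diff_right)
      finally show ?thesis
        using \<open>d \<noteq> 0\<close> by (simp add: divide_simps mult.commute)
    qed
    moreover have "Y \<noteq> {}" using subspace_0[OF Y] by blast
    ultimately have "infdist (d *\<^sub>R z) Y / \<bar>d\<bar> \<le> infdist z Y"
      unfolding infdist_def by (auto intro!: cINF_greatest)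
    then show ?thesis
      using \<open>d \<noteq> 0\<close> by (simp add: divide_simps mult.commute)
  qed
  have "\<bar>c\<bar> * infdist x Y \<le> infdist (c *\<^sub>R x) Y"
    using le[of "1 / c" "c *\<^sub>R x"] False by (simp add: divide_simps mult.commute)
  with le[OF False] show ?thesis by (rule antisym)
qed (use subspace_0[OF Y] in simp)

lemma ncarrier_quotient_nspace: "ncarrier (quotient_nspace Y) = range (coset Y)"
  by (simp add: quotient_nspace_def)

lemma seminormed_quotient_nspace:
  assumes Y: "subspace Y"
  shows "seminormed_nspace (quotient_nspace Y)"
  by unfold_locales
    (auto simp: ncarrier_quotient_nspace nadd_quotient_nspace[OF Y] nscale_quotient_nspace[OF Y]
      nnorm_quotient_nspace[OF Y] infdist_scaleR_subspace[OF Y] infdist_nonneg)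

lemma coset_eq_iff:
  assumes Y: "subspace Y"
  shows "coset Y x = coset Y x' \<longleftrightarrow> x - x' \<in> Y"
proof
  assume "coset Y x = coset Y x'"
  moreover have "x \<in> coset Y x"
    using subspace_0[OF Y] by (force simp: coset_def)
  ultimately obtain y where "y \<in> Y" "x = x' + y"
    by (auto simp: coset_def)
  then show "x - x' \<in> Y" by simp
next
  assume d: "x - x' \<in> Y"
  have "z \<in> coset Y x \<longleftrightarrow> z - x \<in> Y" for z x
    by (force simp: coset_def algebra_simps)
  moreover have "z - x \<in> Y \<longleftrightarrow> z - x' \<in> Y" for z
    using subspace_add[OF Y _ d, of "z - x"] subspace_diff[OF Y _ d, of "z - x'"] by auto
  ultimately show "coset Y x = coset Y x'" by blast
qed

lemma dual_ball_UNIV_iff: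
  fixes f :: "'a::real_normed_vector \<Rightarrow> real"
  shows "f \<in> dual_ball (subspace_nspace UNIV) \<longleftrightarrow> linear f \<and> (\<forall>x. \<bar>f x\<bar> \<le> norm x)"
  unfolding seminormed_nspace.dual_ball_iff[OF seminormed_subspace_nspace[OF subspace_UNIV]]
  by (auto simp: subspace_nspace_def linear_iff)

lemma dual_ball_quotient_iff:
  assumes Y: "subspace Y"
  shows "\<phi> \<in> dual_ball (quotient_nspace Y) \<longleftrightarrow> \<phi> \<in> extensional (range (coset Y)) \<and>
    linear (\<lambda>x. \<phi> (coset Y x)) \<and> (\<forall>x. \<bar>\<phi> (coset Y x)\<bar> \<le> infdist x Y)"
  unfolding seminormed_nspace.dual_ball_iff[OF seminormed_quotient_nspace[OF Y]]
  by (auto simp: ncarrier_quotient_nspace nadd_quotient_nspace[OF Y] nscale_quotient_nspace[OF Y]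
      nnorm_quotient_nspace[OF Y] linear_iff)

lemma continuous_map_restrict_weak_star_ball:
  fixes Y :: "'a::real_normed_vector set"
  assumes Y: "subspace Y"
  shows "continuous_map (weak_star_ball (subspace_nspace UNIV)) (weak_star_ball (subspace_nspace Y))
    (\<lambda>f. restrict f Y)"
proof (rule continuous_map_into_weak_star_ball)
  have "restrict f Y \<in> dual_ball (subspace_nspace Y)" if "linear f" "\<forall>x. \<bar>f x\<bar> \<le> norm x"
    for f :: "'a \<Rightarrow> real"
    unfolding seminormed_nspace.dual_ball_iff[OF seminormed_subspace_nspace[OF Y]]
    using that Y by (auto simp: subspace_nspace_def linear_iff subspace_add subspace_scale)
  then show "(\<lambda>f. restrict f Y) ` topspace (weak_star_ball (subspace_nspace UNIV))
      \<subseteq> dual_ball (subspace_nspace Y)"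
    by (auto simp: topspace_weak_star_ball dual_ball_UNIV_iff)
next
  fix x assume "x \<in> ncarrier (subspace_nspace Y)"
  then show "continuous_map (weak_star_ball (subspace_nspace UNIV)) euclideanreal
      (\<lambda>f. restrict f Y x)"
    using continuous_map_weak_star_ball_eval[of x "subspace_nspace UNIV"]
    by (simp add: subspace_nspace_def)
qed

section \<open>The three-space argument\<close>

text \<open>For a neighbourhood \<open>U\<close> of \<open>f\<close>, the hypothesis on
  \<open>T'\<close> is applied to the image of only that part of \<open>F\<close> near
  \<open>f\<close>, so that the lifted point lands in \<open>U\<close> as well as in the
  fibre.\<close>

lemma closure_of_fibre:
  assumes T: "sequentially_compact_space T" "regular_space T" and T': "Hausdorff_space T'"
    and R: "continuous_map T T' R" and r: "Well_order r" and ord: "sequential_order_le T' r"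
    and F: "F \<subseteq> topspace T" and f: "f \<in> T closure_of F"
  shows "f \<in> T closure_of {g \<in> seq_iter T F r. R g = R f}"
  unfolding in_closure_of
proof (intro conjI allI impI, goal_cases)
  case 1
  show ?case using f by (simp add: in_closure_of)
next
  case (2 U)
  \<comment> \<open>Regularity is needed because iterated limits of points of \<open>V\<close> may
    leave \<open>V\<close>; they do stay in the closed set \<open>C\<close>, which still lies in
    \<open>U\<close>.\<close>
  then obtain V C where V: "openin T V" and C: "closedin T C" and VC: "f \<in> V" "V \<subseteq> C" "C \<subseteq> U"
    using T(2) unfolding neighbourhood_base_of_closedin[symmetric] neighbourhood_base_of by metis
  have VF: "V \<inter> F \<subseteq> topspace T" using F by blast
  have "f \<in> T closure_of (V \<inter> F)"
    using openin_Int_closure_of_subset[OF V] f VC(1) by blast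
  then have "R f \<in> T' closure_of (R ` (V \<inter> F))"
    using continuous_map_image_closure_subset[OF R] by blast
  also have "\<dots> = seq_iter T' (R ` (V \<inter> F)) r"
    using continuous_map_image_subset_topspace[OF R] VF
    by (intro sequential_order_leD[symmetric] ord) blast
  also have "\<dots> \<subseteq> R ` seq_iter T (V \<inter> F) r"
    by (rule seq_iter_image_lift[OF T(1) T' R r VF])
  finally obtain g where g: "g \<in> seq_iter T (V \<inter> F) r" "R g = R f" by auto
  have "g \<in> seq_iter T F r"
    using seq_iter_mono[OF r _ F, of "V \<inter> F"] g(1) by blast
  moreover have "g \<in> C"
    using seq_iter_subset_closure_of[OF r VF] closure_of_minimal[OF _ C, of "V \<inter> F"] VC(2) g(1)
    by blast
  ultimately show ?case using g(2) VC(3) by blast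
qed

text \<open>The set \<open>A\<close> is moved into the quotient ball by \<open>\<psi>\<close>, which
  sends \<open>f\<close> to the zero functional. There the closure is an iterate, and
  \<open>h\<close> carries that iterate back to \<open>T\<close>.\<close>

lemma closure_of_seq_iter_fibre:
  fixes Y :: "'a::real_normed_vector set"
  defines "T \<equiv> weak_star_ball (subspace_nspace (UNIV :: 'a set))"
  assumes Y: "subspace Y" and r: "Well_order r"
    and ord: "sequential_order_le (weak_star_ball (quotient_nspace Y)) r"
    and A: "A \<subseteq> topspace T" "\<And>g y. g \<in> A \<Longrightarrow> y \<in> Y \<Longrightarrow> g y = f y" and f: "f \<in> T closure_of A"
  shows "f \<in> seq_iter T A r"
proof -
  let ?Q = "quotient_nspace Y"
  let ?TQ = "weak_star_ball ?Q"
  have topT: "topspace T = dual_ball (subspace_nspace UNIV)"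
    by (simp add: T_def topspace_weak_star_ball)
  have fB: "f \<in> topspace T"
    using f by (simp add: in_closure_of)
  then have fl: "linear f" "\<And>x. \<bar>f x\<bar> \<le> norm x"
    by (auto simp: topT dual_ball_UNIV_iff)
  define D where "D = {g \<in> topspace T. \<forall>y\<in>Y. g y = f y}"
  \<comment> \<open>\<open>SOME\<close> picks a representative of the coset, and off the cosets the
    value is \<open>undefined\<close>, as membership in the dual ball requires. The map
    \<open>h\<close> below undoes \<open>\<psi>\<close> on \<open>D\<close>.\<close>
  define \<psi> where "\<psi> g = (\<lambda>C\<in>range (coset Y). (g (SOME x. coset Y x = C) - f (SOME x. coset Y x = C)) / 2)"
    for g :: "'a \<Rightarrow> real"
  define h where "h \<phi> x = f x + 2 * \<phi> (coset Y x)" for \<phi> x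
  have \<psi>: "\<psi> g (coset Y x) = (g x - f x) / 2" if "g \<in> D" for g x
  proof -
    define x' where "x' = (SOME x'. coset Y x' = coset Y x)"
    have "coset Y x' = coset Y x"
      unfolding x'_def by (rule someI) (rule refl)
    then have "x' - x \<in> Y"
      by (simp add: coset_eq_iff[OF Y])
    moreover have "linear g"
      using that by (auto simp: D_def topT dual_ball_UNIV_iff)
    \<comment> \<open>Both functionals are linear and agree at \<open>x' - x\<close>, an element of
      \<open>Y\<close>, so the choice of representative does not affect the value.\<close>
    ultimately have "g x' - g x = f x' - f x"
      using that fl(1) by (simp add: D_def flip: linear_diff)
    then show ?thesis
      by (simp add: \<psi>_def flip: x'_def)
  qed
  have h\<psi>: "h (\<psi> g) = g" if "g \<in> D" for g
  proof
    show "h (\<psi> g) x = g x" for x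
      unfolding h_def \<psi>[OF that] by (simp add: field_simps)
  qed
  have \<psi>_ball: "\<psi> g \<in> dual_ball ?Q" if "g \<in> D" for g
    unfolding dual_ball_quotient_iff[OF Y] \<psi>[OF that]
  proof (intro conjI allI)
    have g: "linear g" "\<And>x. \<bar>g x\<bar> \<le> norm x" "\<And>y. y \<in> Y \<Longrightarrow> g y = f y"
      using that by (auto simp: D_def topT dual_ball_UNIV_iff)
    show "\<psi> g \<in> extensional (range (coset Y))"
      by (simp add: \<psi>_def)
    show "linear (\<lambda>x. (g x - f x) / 2)"
      using g(1) fl(1) by (simp add: linear_iff field_simps)
    show "\<bar>(g x - f x) / 2\<bar> \<le> infdist x Y" for x
    proof -
      have "\<bar>(g x - f x) / 2\<bar> \<le> dist x y" if "y \<in> Y" for y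
      proof -
        \<comment> \<open>Shifting by \<open>y\<close> in \<open>Y\<close> does not change the
          difference. Each of the two functionals then contributes at most \<open>dist x y\<close>,
          which explains the halving in \<open>\<psi>\<close>.\<close>
        have "g x - f x = g (x - y) - f (x - y)"
          using g(3)[OF that] by (simp add: linear_diff g(1) fl(1))
        then have "\<bar>g x - f x\<bar> \<le> 2 * dist x y"
          using g(2)[of "x - y"] fl(2)[of "x - y"] unfolding dist_norm by linarith
        then show ?thesis
          by (simp add: abs_divide divide_le_eq mult.commute)
      qed
      moreover have "Y \<noteq> {}" using subspace_0[OF Y] by blast
      ultimately show ?thesis
        unfolding infdist_notempty[OF \<open>Y \<noteq> {}\<close>] by (intro cINF_greatest)
    qed
  qed
  have AD: "A \<subseteq> D" and fD: "f \<in> D"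
    using A fB by (auto simp: D_def)
  have "continuous_map (subtopology T D) ?TQ \<psi>"
  proof (rule continuous_map_into_weak_star_ball)
    show "\<psi> ` topspace (subtopology T D) \<subseteq> dual_ball ?Q"
      using \<psi>_ball by auto
    fix C assume "C \<in> ncarrier ?Q"
    then have "C \<in> range (coset Y)" by (simp add: ncarrier_quotient_nspace)
    \<comment> \<open>For a fixed coset the chosen representative is a fixed vector, so the value
      depends on \<open>g\<close> only through one evaluation.\<close>
    then show "continuous_map (subtopology T D) euclideanreal (\<lambda>g. \<psi> g C)"
      unfolding \<psi>_def T_def
      by (simp, intro continuous_intros continuous_map_from_subtopology
          continuous_map_weak_star_ball_eval) (simp_all add: subspace_nspace_def)
  qed
  from continuous_map_image_closure_subset[OF this, of A]
  have "\<psi> f \<in> ?TQ closure_of \<psi> ` A"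
    using f fD AD by (auto simp: closure_of_subtopology Int_absorb1)
  also have "\<dots> = seq_iter ?TQ (\<psi> ` A) r"
    using \<psi>_ball AD by (intro sequential_order_leD[symmetric] ord) (auto simp: topspace_weak_star_ball)
  finally have "h (\<psi> f) \<in> h ` seq_iter ?TQ (\<psi> ` A) r" by (rule imageI)
  also have "\<dots> \<subseteq> seq_iter T (h ` \<psi> ` A) r"
  proof (rule conjunct2[OF seq_iter_seq_continuous_image[OF r]])
    \<comment> \<open>For a general \<open>\<phi>\<close> in the quotient ball,
      \<open>h \<phi>\<close> can have norm greater than one. Restricting to those that land in the
      ball is harmless, since this set contains its sequential limits.\<close>
    let ?E = "{\<phi> \<in> dual_ball ?Q. h \<phi> \<in> topspace T}"
    show "\<psi> ` A \<subseteq> ?E"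
      using AD \<psi>_ball h\<psi> A(1) by (auto simp: subset_iff)
    show "?E \<subseteq> topspace ?TQ" "h ` ?E \<subseteq> topspace T"
      by (auto simp: topspace_weak_star_ball)
    fix \<sigma> l assume \<sigma>: "\<And>n. \<sigma> n \<in> ?E" and "limitin ?TQ \<sigma> l sequentially"
    then have l: "l \<in> dual_ball ?Q" "\<And>x. (\<lambda>n. \<sigma> n (coset Y x)) \<longlonglongrightarrow> l (coset Y x)"
      using limitin_weak_star_ball[of \<sigma> ?Q l] by (auto simp: ncarrier_quotient_nspace)
    have lim: "(\<lambda>n. h (\<sigma> n) x) \<longlonglongrightarrow> h l x" for x
      unfolding h_def by (intro tendsto_add tendsto_const tendsto_mult_left l(2))
    have "h l \<in> dual_ball (subspace_nspace UNIV)"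
    proof (rule seminormed_nspace.dual_ball_pointwise_limit[OF seminormed_subspace_nspace[OF subspace_UNIV]])
      show "h (\<sigma> n) \<in> dual_ball (subspace_nspace UNIV)" for n
        using \<sigma>[of n] by (simp add: topT)
      show "h l \<in> extensional (ncarrier (subspace_nspace UNIV))"
        by (simp add: subspace_nspace_def)
    qed (rule lim)
    then show "l \<in> ?E \<and> limitin T (h \<circ> \<sigma>) (h l) sequentially"
      using l(1) \<sigma> lim limitin_weak_star_ball[of "h \<circ> \<sigma>" "subspace_nspace UNIV" "h l"]
      by (auto simp: topT simp flip: T_def)
  qed
  also have "h ` \<psi> ` A = A"
    using h\<psi> AD by (force simp: image_image)
  finally show ?thesis
    using h\<psi>[OF fD] by simp
qed

theorem theorem1:
  fixes Y :: "'a::banach set" and \<gamma>1 :: "'o1 rel" and \<gamma>2 :: "'o2 rel"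
  assumes "weak_star_seq_compact_dual_ball (subspace_nspace (UNIV :: 'a set))"
    and "Well_order \<gamma>1" and "Well_order \<gamma>2"
    and "subspace Y" and "closed Y"
    and "weak_star_sequential_dual_ball_le (subspace_nspace Y) \<gamma>1"
    and "weak_star_sequential_dual_ball_le (quotient_nspace Y) \<gamma>2"
  shows "weak_star_sequential_dual_ball_le (subspace_nspace (UNIV :: 'a set)) (ord_sum \<gamma>1 \<gamma>2)"
proof -
  let ?T = "weak_star_ball (subspace_nspace (UNIV :: 'a set))"
  note wo = Well_order_ord_sum[OF assms(2,3)]
  have sc: "sequentially_compact_space ?T"
    and Y_ord: "sequential_order_le (weak_star_ball (subspace_nspace Y)) \<gamma>1"
    and Q_ord: "sequential_order_le (weak_star_ball (quotient_nspace Y)) \<gamma>2"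
    using assms by (auto simp: weak_star_seq_compact_dual_ball_def weak_star_sequential_dual_ball_le_def)
  have "sequential_order_le ?T (ord_sum \<gamma>1 \<gamma>2)"
  proof (intro sequential_order_leI wo equalityI)
    fix F assume F: "F \<subseteq> topspace ?T"
    show "seq_iter ?T F (ord_sum \<gamma>1 \<gamma>2) \<subseteq> ?T closure_of F"
      by (rule seq_iter_subset_closure_of[OF wo F])
    show "?T closure_of F \<subseteq> seq_iter ?T F (ord_sum \<gamma>1 \<gamma>2)"
    proof
      fix f assume f: "f \<in> ?T closure_of F"
      let ?S = "seq_iter ?T F \<gamma>1"
      let ?A = "{g \<in> ?S. restrict g Y = restrict f Y}"
      have S: "?S \<subseteq> topspace ?T"
        by (rule seq_iter_subset_topspace[OF assms(2) F])
      have "f \<in> ?T closure_of ?A"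
        by (rule closure_of_fibre[OF sc regular_weak_star_ball Hausdorff_weak_star_ball
              continuous_map_restrict_weak_star_ball[OF assms(4)] assms(2) Y_ord F f])
      \<comment> \<open>Equality of the restrictions is equality on \<open>Y\<close>, the form in
        which the quotient argument uses it.\<close>
      moreover have "g y = f y" if "g \<in> ?A" "y \<in> Y" for g y
        using that by (metis (mono_tags, lifting) mem_Collect_eq restrict_apply')
      ultimately have "f \<in> seq_iter ?T ?A \<gamma>2"
        using S by (intro closure_of_seq_iter_fibre[OF assms(4) assms(3) Q_ord]) auto
      also have "\<dots> \<subseteq> seq_iter ?T ?S \<gamma>2"
        by (intro seq_iter_mono assms(3) S) auto
      also have "\<dots> \<subseteq> seq_iter ?T F (ord_sum \<gamma>1 \<gamma>2)"
        by (rule seq_iter_seq_iter_subset[OF assms(2,3) F])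
      finally show "f \<in> seq_iter ?T F (ord_sum \<gamma>1 \<gamma>2)" .
    qed
  qed
  \<comment> \<open>Sequentiality follows from the order bound: a sequentially closed set equals all
    its iterates, hence its closure.\<close>
  then show ?thesis
    unfolding weak_star_sequential_dual_ball_le_def
    using sequential_order_le_imp_sequential_space[OF wo] by blast
qed

end
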